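(* Every arrow of $\mathrm{Spr}(\mathbf{Rel}_f^{\mathcal{M}})$ is equal to an expression built from the ten arrows $\Delta, \bot, \nabla, \top, \Lambda, \downarrow, \mathsf{V}, \uparrow, \mathsf{I}, \mathsf{X}$ (defined below) using only composition $;$ and tensor $\otimes$.
   Context: For a set $X$, $\mathcal{M}(X)$ is the set of finitely supported functions $X\to\mathbb{N}$ (multisets); an ordinary subset is regarded as a multiset with multiplicities $0/1$. For $h : A \to \mathcal{M}(X)$, $h^\#(\mathcal{U}) = \sum_{a\in A}\mathcal{U}(a)\,h(a)$. $\mathbf{Rel}_f^{\mathcal{M}}$ has objects finite sets, arrows $A \nrightarrow X$ the functions $A \to \mathcal{M}(X)$, identity $a\mapsto\{a\}$ and composition $k\circ h = k^\#\circ h$. A multi $(f,g)$-synchronisation for $f : A\nrightarrow X$, $g : B \nrightarrow X$ is a pair $(\mathcal{U},\mathcal{V})\in\mathcal{M}(A)\times\mathcal{M}(B)$ with $f^\#(\mathcal{U}) = g^\#(\mathcal{V})$, ordered pointwise; it is minimal if nonzero and every synchronisation below it is $(0,0)$ or equal to it. $\mathrm{Spr}(\mathbf{Rel}_f^{\mathcal{M}})$ has objects natural numbers $k$ (identified with $\{0,\dots,k-1\}$) and arrows $k\to l$ the isomorphism classes of spans $k \xleftarrow{a} x \xrightarrow{b} l$ in $\mathbf{Rel}_f^{\mathcal{M}}$, $x$ finite, with $y \mapsto (a(y),b(y))$ injective $x \to \mathcal{M}(k)\times\mathcal{M}(l)$. Composition $;$ (diagrammatic order) of $k_0 \xleftarrow{f_0}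 x_0 \xrightarrow{g_0} k_1$ and $k_1 \xleftarrow{f_1} x_1 \xrightarrow{g_1} k_2$: take the set $S$ of minimal $(g_0,f_1)$-synchronisations, map $\sigma = (\mathcal{U},\mathcal{V}) \mapsto (f_0^\#(\mathcal{U}), g_1^\#(\mathcal{V})) \in \mathcal{M}(k_0)\times\mathcal{M}(k_2)$, and take as composite the image of this map with the two projections as legs. The tensor $\otimes$ takes disjoint unions of boundaries and carriers, with legs acting componentwise and $k_1+k_2$ identified with the ordinal $k_1+k_2$. Writing a span as (carrier; left leg; right leg): $\Delta : 1 \to 2$ is ($\{0\}$; $0\mapsto\{0\}$; $0\mapsto\{0,1\}$); $\bot : 1\to 0$ is ($\{0\}$; $0\mapsto\{0\}$; $0 \mapsto \varnothing$); $\nabla : 2\to 1$ is ($\{0\}$; $0\mapsto\{0,1\}$; $0\mapsto\{0\}$); $\top : 0 \to 1$ is ($\{0\}$; $0\mapsto\varnothing$; $0\mapsto\{0\}$); $\Lambda : 1\to 2$ is ($\{0,1\}$; $i\mapsto\{0\}$; $i\mapsto\{i\}$); $\downarrow : 1 \to 0$ has empty carrier; $\mathsf{V} : 2 \to 1$ is ($\{0,1\}$; $i\mapsto\{i\}$; $i\mapsto\{0\}$); $\uparrow : 0\to 1$ has empty carrier; $\mathsf{I} : 1\to 1$ is ($\{0\}$; $0\mapsto\{0\}$; $0\mapsto\{0\}$); $\mathsf{X} : 2\to 2$ is ($\{0,1\}$; $i\mapsto\{i\}$; $i\mapsto\{1-i\}$). *)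

theory Defs
  imports "HOL-Library.Multiset" "HOL-Library.FuncSet"
begin

section \<open>The category of finite sets and multirelations\<close>

definition msets :: "'a set \<Rightarrow> 'a multiset set" where
  "msets X = {U. set_mset U \<subseteq> X}"

text \<open>\<open>ext h\<close> is \<open>h\<^sup>#\<close>; see \<open>ext_eq_sum\<close> for the multiplicity form of the sum.\<close>

definition ext :: "('a \<Rightarrow> 'b multiset) \<Rightarrow> 'a multiset \<Rightarrow> 'b multiset" where
  "ext h U = (\<Sum>a\<in>#U. h a)"

lemma ext_eq_sum:
  assumes "finite A" "U \<in> msets A"
  shows "ext h U = (\<Sum>a\<in>A. repeat_mset (count U a) (h a))"
proof -
  have "(\<Sum>a\<in>#U. h a) = (\<Sum>a\<in>A. repeat_mset (count U a) (h a))" if "set_mset U \<subseteq> A" for U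
    using that
  proof (induction U)
    case empty
    then show ?case by simp
  next
    case (add x U)
    have "(\<Sum>a\<in>A. repeat_mset (count (add_mset x U) a) (h a))
        = (\<Sum>a\<in>A. repeat_mset (count U a) (h a) + (if a = x then h a else {#}))"
      by (rule sum.cong) auto
    also have "\<dots> = (\<Sum>a\<in>A. repeat_mset (count U a) (h a)) + h x"
      using add.prems assms(1) by (simp add: sum.distrib)
    finally show ?case using add by (simp add: add.commute)
  qed
  then show ?thesis using assms by (simp add: ext_def msets_def)
qed

definition rel_id :: "'a \<Rightarrow> 'a multiset" where
  "rel_id a = {#a#}"

definition rel_comp :: "('b \<Rightarrow> 'c multiset) \<Rightarrow> ('a \<Rightarrow> 'b multiset) \<Rightarrow> 'a \<Rightarrow> 'c multiset"
    (infixr "\<circ>\<^sub>M" 55) where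
  "k \<circ>\<^sub>M h = ext k \<circ> h"

section \<open>Minimal multi-synchronisations\<close>

definition syncs ::
  "'a set \<Rightarrow> 'b set \<Rightarrow> ('a \<Rightarrow> 'c multiset) \<Rightarrow> ('b \<Rightarrow> 'c multiset)
    \<Rightarrow> ('a multiset \<times> 'b multiset) set" where
  "syncs A B f g = {(U, V). U \<in> msets A \<and> V \<in> msets B \<and> ext f U = ext g V}"

definition min_syncs ::
  "'a set \<Rightarrow> 'b set \<Rightarrow> ('a \<Rightarrow> 'c multiset) \<Rightarrow> ('b \<Rightarrow> 'c multiset)
    \<Rightarrow> ('a multiset \<times> 'b multiset) set" where
  "min_syncs A B f g =
    {(U, V). (U, V) \<in> syncs A B f g \<and> (U, V) \<noteq> ({#}, {#}) \<and>
       (\<forall>U' V'. (U', V') \<in> syncs A B f g \<and> U' \<subseteq># U \<and> V' \<subseteq># V \<longrightarrow>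
          (U', V') = ({#}, {#}) \<or> (U', V') = (U, V))}"

section \<open>Spans and their isomorphism classes\<close>

record 'x mspan =
  src :: nat
  tgt :: nat
  apex :: "'x set"
  lleg :: "'x \<Rightarrow> nat multiset"
  rleg :: "'x \<Rightarrow> nat multiset"

definition is_mspan :: "'x mspan \<Rightarrow> bool" where
  "is_mspan s \<longleftrightarrow>
     finite (apex s) \<and>
     lleg s \<in> apex s \<rightarrow> msets {..<src s} \<and>
     rleg s \<in> apex s \<rightarrow> msets {..<tgt s} \<and>
     inj_on (\<lambda>y. (lleg s y, rleg s y)) (apex s)"

text \<open>An arrow out of a finite set is represented by a total function whose values off that
  set are irrelevant, so equality of arrows means agreement on the set.\<close>

definition mspan_iso :: "'x mspan \<Rightarrow> 'y mspan \<Rightarrow> bool" where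
  "mspan_iso s t \<longleftrightarrow>
     src s = src t \<and> tgt s = tgt t \<and>
     (\<exists>\<phi> \<in> apex s \<rightarrow> msets (apex t). \<exists>\<psi> \<in> apex t \<rightarrow> msets (apex s).
        (\<forall>y\<in>apex s. (\<psi> \<circ>\<^sub>M \<phi>) y = rel_id y) \<and>
        (\<forall>z\<in>apex t. (\<phi> \<circ>\<^sub>M \<psi>) z = rel_id z) \<and>
        (\<forall>y\<in>apex s. (lleg t \<circ>\<^sub>M \<phi>) y = lleg s y) \<and>
        (\<forall>y\<in>apex s. (rleg t \<circ>\<^sub>M \<phi>) y = rleg s y))"

text \<open>An isomorphism class is represented by the set of its members whose carrier is a finite
  set of natural numbers. The representative may have a carrier of any type; as every finite
  set is in bijection with a set of natural numbers, no class is lost (see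
  \<open>mspan_class_in_arrows\<close> below).\<close>

type_synonym arrow = "nat mspan set"

definition mspan_class :: "'x mspan \<Rightarrow> arrow" where
  "mspan_class s = {t. is_mspan t \<and> mspan_iso t s}"

definition Spr_arrows :: "nat \<Rightarrow> nat \<Rightarrow> arrow set" where
  "Spr_arrows k l = {mspan_class s | s :: nat mspan. is_mspan s \<and> src s = k \<and> tgt s = l}"

section \<open>Composition and tensor\<close>

definition mspan_seq ::
  "'x mspan \<Rightarrow> 'y mspan \<Rightarrow> (nat multiset \<times> nat multiset) mspan" where
  "mspan_seq s t =
     \<lparr>src = src s, tgt = tgt t,
      apex = (\<lambda>(U, V). (ext (lleg s) U, ext (rleg t) V)) `
               min_syncs (apex s) (apex t) (rleg s) (lleg t),
      lleg = fst, rleg = snd\<rparr>"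

definition mspan_tensor :: "'x mspan \<Rightarrow> 'y mspan \<Rightarrow> ('x + 'y) mspan" where
  "mspan_tensor s t =
     \<lparr>src = src s + src t, tgt = tgt s + tgt t,
      apex = apex s <+> apex t,
      lleg = case_sum (lleg s) (\<lambda>y. image_mset (\<lambda>i. src s + i) (lleg t y)),
      rleg = case_sum (rleg s) (\<lambda>y. image_mset (\<lambda>i. tgt s + i) (rleg t y))\<rparr>"

text \<open>The unions range over all representatives; they do not depend on the choice, see
  \<open>arrow_seq_class\<close> and \<open>arrow_tensor_class\<close> below.\<close>

definition arrow_seq :: "arrow \<Rightarrow> arrow \<Rightarrow> arrow" (infixr ";;" 60) where
  "F ;; G = (\<Union>s\<in>F. \<Union>t\<in>G. mspan_class (mspan_seq s t))"

definition arrow_tensor :: "arrow \<Rightarrow> arrow \<Rightarrow> arrow" (infixr "\<otimes>" 65) where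
  "F \<otimes> G = (\<Union>s\<in>F. \<Union>t\<in>G. mspan_class (mspan_tensor s t))"

section \<open>Expressions over the ten generators\<close>

datatype gen = Delta | Bot | Nabla | Top | Lambda | Down | Vee | Up | Ident | Cross

fun gen_mspan :: "gen \<Rightarrow> nat mspan" where
  "gen_mspan Delta = \<lparr>src = 1, tgt = 2, apex = {0}, lleg = (\<lambda>_. {#0#}), rleg = (\<lambda>_. {#0, 1#})\<rparr>"
| "gen_mspan Bot = \<lparr>src = 1, tgt = 0, apex = {0}, lleg = (\<lambda>_. {#0#}), rleg = (\<lambda>_. {#})\<rparr>"
| "gen_mspan Nabla = \<lparr>src = 2, tgt = 1, apex = {0}, lleg = (\<lambda>_. {#0, 1#}), rleg = (\<lambda>_. {#0#})\<rparr>"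
| "gen_mspan Top = \<lparr>src = 0, tgt = 1, apex = {0}, lleg = (\<lambda>_. {#}), rleg = (\<lambda>_. {#0#})\<rparr>"
| "gen_mspan Lambda = \<lparr>src = 1, tgt = 2, apex = {0, 1}, lleg = (\<lambda>_. {#0#}), rleg = (\<lambda>i. {#i#})\<rparr>"
| "gen_mspan Down = \<lparr>src = 1, tgt = 0, apex = {}, lleg = (\<lambda>_. {#}), rleg = (\<lambda>_. {#})\<rparr>"
| "gen_mspan Vee = \<lparr>src = 2, tgt = 1, apex = {0, 1}, lleg = (\<lambda>i. {#i#}), rleg = (\<lambda>_. {#0#})\<rparr>"
| "gen_mspan Up = \<lparr>src = 0, tgt = 1, apex = {}, lleg = (\<lambda>_. {#}), rleg = (\<lambda>_. {#})\<rparr>"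
| "gen_mspan Ident = \<lparr>src = 1, tgt = 1, apex = {0}, lleg = (\<lambda>_. {#0#}), rleg = (\<lambda>_. {#0#})\<rparr>"
| "gen_mspan Cross = \<lparr>src = 2, tgt = 2, apex = {0, 1}, lleg = (\<lambda>i. {#i#}), rleg = (\<lambda>i. {#1 - i#})\<rparr>"

datatype expr = Gen gen | Seq expr expr | Tensor expr expr

inductive has_type :: "expr \<Rightarrow> nat \<Rightarrow> nat \<Rightarrow> bool" where
  "has_type (Gen c) (src (gen_mspan c)) (tgt (gen_mspan c))"
| "has_type d k l \<Longrightarrow> has_type e l m \<Longrightarrow> has_type (Seq d e) k m"
| "has_type d k l \<Longrightarrow> has_type e k' l' \<Longrightarrow> has_type (Tensor d e) (k + k') (l + l')"

fun denote :: "expr \<Rightarrow> arrow" where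
  "denote (Gen c) = mspan_class (gen_mspan c)"
| "denote (Seq d e) = denote d ;; denote e"
| "denote (Tensor d e) = denote d \<otimes> denote e"

section \<open>Consistency of the representation\<close>

lemma ext_empty [simp]: "ext h {#} = {#}"
  by (simp add: ext_def)

lemma ext_single [simp]: "ext h {#a#} = h a"
  by (simp add: ext_def)

lemma ext_union [simp]: "ext h (U + V) = ext h U + ext h V"
  by (simp add: ext_def)

lemma ext_add_mset [simp]: "ext h (add_mset a U) = h a + ext h U"
  by (simp add: ext_def)

lemma ext_mem: "h \<in> A \<rightarrow> msets X \<Longrightarrow> U \<in> msets A \<Longrightarrow> ext h U \<in> msets X"
  by (induction U) (auto simp: msets_def Pi_def)

lemma ext_cong: "U \<in> msets A \<Longrightarrow> (\<And>a. a \<in> A \<Longrightarrow> h a = h' a) \<Longrightarrow> ext h U = ext h' U"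
  by (induction U) (auto simp: msets_def)

lemma rel_comp_apply: "(k \<circ>\<^sub>M h) x = ext k (h x)"
  by (simp add: rel_comp_def)

lemma ext_rel_comp: "ext (k \<circ>\<^sub>M h) U = ext k (ext h U)"
  by (induction U) (auto simp: rel_comp_def)

lemma ext_rel_id [simp]: "ext rel_id U = U"
  by (induction U) (auto simp: rel_id_def)

lemma ext_mono: "U \<subseteq># V \<Longrightarrow> ext h U \<subseteq># ext h V"
  by (metis ext_union mset_subset_eq_add_left subset_mset.add_diff_inverse)

lemma mspan_iso_refl: "mspan_iso s s"
  unfolding mspan_iso_def
  by (intro conjI refl bexI[of _ rel_id]) (auto simp: rel_comp_apply rel_id_def msets_def)

lemma mspan_iso_legs_inverse:
  assumes "\<phi> \<in> apex s \<rightarrow> msets (apex t)" "\<psi> \<in> apex t \<rightarrow> msets (apex s)"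
    and "\<forall>z\<in>apex t. (\<phi> \<circ>\<^sub>M \<psi>) z = rel_id z" "\<forall>y\<in>apex s. (h \<circ>\<^sub>M \<phi>) y = h' y"
    and "z \<in> apex t"
  shows "(h' \<circ>\<^sub>M \<psi>) z = h z"
proof -
  have "\<psi> z \<in> msets (apex s)" using assms by auto
  then have "ext h' (\<psi> z) = ext (h \<circ>\<^sub>M \<phi>) (\<psi> z)" using assms(4) by (intro ext_cong) auto
  also have "\<dots> = ext h ((\<phi> \<circ>\<^sub>M \<psi>) z)" by (simp add: ext_rel_comp rel_comp_apply)
  also have "\<dots> = h z" using assms by (simp add: rel_id_def)
  finally show ?thesis by (simp add: rel_comp_apply)
qed

lemma mspan_iso_sym:
  assumes "mspan_iso s t"
  shows "mspan_iso t s"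
proof -
  obtain \<phi> \<psi> where i: "\<phi> \<in> apex s \<rightarrow> msets (apex t)" "\<psi> \<in> apex t \<rightarrow> msets (apex s)"
    "\<forall>y\<in>apex s. (\<psi> \<circ>\<^sub>M \<phi>) y = rel_id y" "\<forall>z\<in>apex t. (\<phi> \<circ>\<^sub>M \<psi>) z = rel_id z"
    "\<forall>y\<in>apex s. (lleg t \<circ>\<^sub>M \<phi>) y = lleg s y" "\<forall>y\<in>apex s. (rleg t \<circ>\<^sub>M \<phi>) y = rleg s y"
    and "src s = src t" "tgt s = tgt t"
    using assms unfolding mspan_iso_def by blast
  moreover have "\<forall>z\<in>apex t. (lleg s \<circ>\<^sub>M \<psi>) z = lleg t z"
    using mspan_iso_legs_inverse[OF i(1,2,4,5)] by blast
  moreover have "\<forall>z\<in>apex t. (rleg s \<circ>\<^sub>M \<psi>) z = rleg t z"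
    using mspan_iso_legs_inverse[OF i(1,2,4,6)] by blast
  ultimately show ?thesis
    unfolding mspan_iso_def
    by (intro conjI bexI[of _ \<psi>] bexI[of _ \<phi>]) simp_all
qed

lemma mspan_iso_trans:
  assumes "mspan_iso s t" "mspan_iso t u"
  shows "mspan_iso s u"
proof -
  obtain p q where pq: "p \<in> apex s \<rightarrow> msets (apex t)" "q \<in> apex t \<rightarrow> msets (apex s)"
    "\<And>y. y\<in>apex s \<Longrightarrow> ext q (p y) = rel_id y" "\<And>z. z\<in>apex t \<Longrightarrow> ext p (q z) = rel_id z"
    "\<And>y. y\<in>apex s \<Longrightarrow> ext (lleg t) (p y) = lleg s y"
    "\<And>y. y\<in>apex s \<Longrightarrow> ext (rleg t) (p y) = rleg s y"
    using assms(1) unfolding mspan_iso_def rel_comp_apply by auto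
  obtain p' q' where pq': "p' \<in> apex t \<rightarrow> msets (apex u)" "q' \<in> apex u \<rightarrow> msets (apex t)"
    "\<And>y. y\<in>apex t \<Longrightarrow> ext q' (p' y) = rel_id y" "\<And>z. z\<in>apex u \<Longrightarrow> ext p' (q' z) = rel_id z"
    "\<And>y. y\<in>apex t \<Longrightarrow> ext (lleg u) (p' y) = lleg t y"
    "\<And>y. y\<in>apex t \<Longrightarrow> ext (rleg u) (p' y) = rleg t y"
    using assms(2) unfolding mspan_iso_def rel_comp_apply by auto
  have collapse: "ext h (ext k U) = ext h' U"
    if "U \<in> msets A" "\<And>a. a \<in> A \<Longrightarrow> ext h (k a) = h' a"
    for h :: "'d \<Rightarrow> 'e multiset" and k :: "'f \<Rightarrow> 'd multiset" and h' U A
    using ext_cong[OF that(1), of "h \<circ>\<^sub>M k" h'] that(2) by (simp add: ext_rel_comp rel_comp_apply)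
  have pm: "\<And>y. y \<in> apex s \<Longrightarrow> p y \<in> msets (apex t)"
    and qm: "\<And>z. z \<in> apex u \<Longrightarrow> q' z \<in> msets (apex t)" using pq pq' by auto
  have "ext q (ext q' (ext p' (p y))) = rel_id y" if "y \<in> apex s" for y
    using collapse[OF pm[OF that] pq'(3)] pq(3)[OF that] by simp
  moreover have "ext p' (ext p (ext q (q' z))) = rel_id z" if "z \<in> apex u" for z
    using collapse[OF qm[OF that] pq(4)] pq'(4)[OF that] by simp
  moreover have "ext (lleg u) (ext p' (p y)) = lleg s y" if "y \<in> apex s" for y
    using collapse[OF pm[OF that] pq'(5)] pq(5)[OF that] by simp
  moreover have "ext (rleg u) (ext p' (p y)) = rleg s y" if "y \<in> apex s" for y
    using collapse[OF pm[OF that] pq'(6)] pq(6)[OF that] by simp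
  moreover have "p' \<circ>\<^sub>M p \<in> apex s \<rightarrow> msets (apex u)" "q \<circ>\<^sub>M q' \<in> apex u \<rightarrow> msets (apex s)"
    using ext_mem[OF pq'(1) pm] ext_mem[OF pq(2) qm] by (auto simp: rel_comp_apply)
  moreover have "src s = src u" "tgt s = tgt u"
    using assms by (auto simp: mspan_iso_def)
  ultimately show ?thesis
    unfolding mspan_iso_def
    by (intro conjI bexI[of _ "p' \<circ>\<^sub>M p"] bexI[of _ "q \<circ>\<^sub>M q'"])
       (simp_all add: ext_rel_comp rel_comp_apply)
qed

lemma mspan_class_eqI: "mspan_iso s t \<Longrightarrow> mspan_class s = mspan_class t"
  by (auto simp: mspan_class_def intro: mspan_iso_trans[OF _ mspan_iso_sym] elim: mspan_iso_trans)

lemma ex_nat_mspan: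
  assumes "is_mspan s"
  shows "\<exists>t :: nat mspan. is_mspan t \<and> mspan_iso t s"
proof -
  obtain n and f :: "nat \<Rightarrow> 'a" where "apex s = f ` {i. i < n}" "inj_on f {i. i < n}"
    using assms finite_imp_nat_seg_image_inj_on[of "apex s"] unfolding is_mspan_def by blast
  then have f: "bij_betw f {..<n} (apex s)" by (auto simp: bij_betw_def lessThan_def)
  let ?t = "\<lparr>src = src s, tgt = tgt s, apex = {..<n}, lleg = lleg s \<circ> f, rleg = rleg s \<circ> f\<rparr>"
  have "is_mspan ?t"
    using assms f comp_inj_on[of f "{..<n}" "\<lambda>y. (lleg s y, rleg s y)"]
    unfolding is_mspan_def by (auto simp: bij_betw_def comp_def Pi_def)
  moreover have "mspan_iso ?t s"
    unfolding mspan_iso_def rel_comp_apply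
    using f bij_betw_inv_into_left[OF f] bij_betw_inv_into_right[OF f]
      bij_betwE[OF f] bij_betwE[OF bij_betw_inv_into[OF f]]
    by (intro conjI bexI[of _ "\<lambda>i. {#f i#}"] bexI[of _ "\<lambda>z. {#inv_into {..<n} f z#}"])
       (auto simp: rel_id_def msets_def)
  ultimately show ?thesis by blast
qed

lemma mspan_class_in_arrows:
  assumes "is_mspan s"
  shows "mspan_class s \<in> Spr_arrows (src s) (tgt s)"
proof -
  obtain t :: "nat mspan" where t: "is_mspan t" "mspan_iso t s"
    using ex_nat_mspan[OF assms] by blast
  then have "src t = src s" "tgt t = tgt s" by (auto simp: mspan_iso_def)
  then show ?thesis using t mspan_class_eqI[OF t(2)] unfolding Spr_arrows_def by blast
qed

lemma is_mspan_gen: "is_mspan (gen_mspan c)"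
  by (cases c) (auto simp: is_mspan_def msets_def)

text \<open>Composition and tensor may be computed on arbitrary representatives.\<close>

lemma mspan_iso_transport:
  assumes "mspan_iso s t"
  obtains p q where
    "\<And>U. U \<in> msets (apex s) \<Longrightarrow> ext p U \<in> msets (apex t)"
    "\<And>V. V \<in> msets (apex t) \<Longrightarrow> ext q V \<in> msets (apex s)"
    "\<And>U. U \<in> msets (apex s) \<Longrightarrow> ext q (ext p U) = U"
    "\<And>V. V \<in> msets (apex t) \<Longrightarrow> ext p (ext q V) = V"
    "\<And>U. U \<in> msets (apex s) \<Longrightarrow> ext (lleg t) (ext p U) = ext (lleg s) U"
    "\<And>U. U \<in> msets (apex s) \<Longrightarrow> ext (rleg t) (ext p U) = ext (rleg s) U"
    "\<And>V. V \<in> msets (apex t) \<Longrightarrow> ext (lleg s) (ext q V) = ext (lleg t) V"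
    "\<And>V. V \<in> msets (apex t) \<Longrightarrow> ext (rleg s) (ext q V) = ext (rleg t) V"
proof -
  obtain p q where i: "p \<in> apex s \<rightarrow> msets (apex t)" "q \<in> apex t \<rightarrow> msets (apex s)"
    "\<forall>y\<in>apex s. (q \<circ>\<^sub>M p) y = rel_id y" "\<forall>z\<in>apex t. (p \<circ>\<^sub>M q) z = rel_id z"
    "\<forall>y\<in>apex s. (lleg t \<circ>\<^sub>M p) y = lleg s y" "\<forall>y\<in>apex s. (rleg t \<circ>\<^sub>M p) y = rleg s y"
    using assms unfolding mspan_iso_def by blast
  have c: "ext k (ext h U) = ext g U" if "U \<in> msets A" "\<forall>a\<in>A. (k \<circ>\<^sub>M h) a = g a"
    for k :: "'d \<Rightarrow> 'e multiset" and h :: "'f \<Rightarrow> 'd multiset" and g U A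
    using ext_cong[OF that(1), of "k \<circ>\<^sub>M h" g] that(2) by (simp add: ext_rel_comp)
  have bk: "ext (lleg s) (ext q V) = ext (lleg t) V" "ext (rleg s) (ext q V) = ext (rleg t) V"
    if "V \<in> msets (apex t)" for V
    using c[OF that] mspan_iso_legs_inverse[OF i(1,2,4,5)] mspan_iso_legs_inverse[OF i(1,2,4,6)]
    by blast+
  show ?thesis
    using ext_mem[OF i(1)] ext_mem[OF i(2)] c[OF _ i(3)] c[OF _ i(4)] c[OF _ i(5)] c[OF _ i(6)] bk
    by (intro that[of p q]) simp_all
qed

lemma mspan_seq_cong_aux:
  assumes "mspan_iso s s'" "mspan_iso t t'"
  shows "apex (mspan_seq s t) \<subseteq> apex (mspan_seq s' t')"
proof
  fix x assume "x \<in> apex (mspan_seq s t)"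
  then obtain U V where UV: "(U, V) \<in> min_syncs (apex s) (apex t) (rleg s) (lleg t)"
    and x: "x = (ext (lleg s) U, ext (rleg t) V)"
    by (auto simp: mspan_seq_def)
  obtain p q where pq:
    "\<And>U. U \<in> msets (apex s) \<Longrightarrow> ext p U \<in> msets (apex s')"
    "\<And>V. V \<in> msets (apex s') \<Longrightarrow> ext q V \<in> msets (apex s)"
    "\<And>U. U \<in> msets (apex s) \<Longrightarrow> ext q (ext p U) = U"
    "\<And>V. V \<in> msets (apex s') \<Longrightarrow> ext p (ext q V) = V"
    "\<And>U. U \<in> msets (apex s) \<Longrightarrow> ext (lleg s') (ext p U) = ext (lleg s) U"
    "\<And>U. U \<in> msets (apex s) \<Longrightarrow> ext (rleg s') (ext p U) = ext (rleg s) U"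
    "\<And>V. V \<in> msets (apex s') \<Longrightarrow> ext (lleg s) (ext q V) = ext (lleg s') V"
    "\<And>V. V \<in> msets (apex s') \<Longrightarrow> ext (rleg s) (ext q V) = ext (rleg s') V"
    by (fact mspan_iso_transport[OF assms(1)])
  obtain p' q' where pq':
    "\<And>U. U \<in> msets (apex t) \<Longrightarrow> ext p' U \<in> msets (apex t')"
    "\<And>V. V \<in> msets (apex t') \<Longrightarrow> ext q' V \<in> msets (apex t)"
    "\<And>U. U \<in> msets (apex t) \<Longrightarrow> ext q' (ext p' U) = U"
    "\<And>V. V \<in> msets (apex t') \<Longrightarrow> ext p' (ext q' V) = V"
    "\<And>U. U \<in> msets (apex t) \<Longrightarrow> ext (lleg t') (ext p' U) = ext (lleg t) U"
    "\<And>U. U \<in> msets (apex t) \<Longrightarrow> ext (rleg t') (ext p' U) = ext (rleg t) U"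
    "\<And>V. V \<in> msets (apex t') \<Longrightarrow> ext (lleg t) (ext q' V) = ext (lleg t') V"
    "\<And>V. V \<in> msets (apex t') \<Longrightarrow> ext (rleg t) (ext q' V) = ext (rleg t') V"
    by (fact mspan_iso_transport[OF assms(2)])
  have U: "U \<in> msets (apex s)" "V \<in> msets (apex t)" "ext (rleg s) U = ext (lleg t) V"
      "(U, V) \<noteq> ({#}, {#})"
    and min: "\<And>U' V'. (U', V') \<in> syncs (apex s) (apex t) (rleg s) (lleg t) \<Longrightarrow>
      U' \<subseteq># U \<Longrightarrow> V' \<subseteq># V \<Longrightarrow> (U', V') = ({#}, {#}) \<or> (U', V') = (U, V)"
    using UV by (auto simp: min_syncs_def syncs_def)
  have nz: "(ext p U, ext p' V) \<noteq> ({#}, {#})"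
    using U pq(3)[OF U(1)] pq'(3)[OF U(2)] by auto
  have "(U', V') = ({#}, {#}) \<or> (U', V') = (ext p U, ext p' V)"
    if "(U', V') \<in> syncs (apex s') (apex t') (rleg s') (lleg t')" "U' \<subseteq># ext p U" "V' \<subseteq># ext p' V"
    for U' V'
  proof -
    have m: "U' \<in> msets (apex s')" "V' \<in> msets (apex t')" "ext (rleg s') U' = ext (lleg t') V'"
      using that by (auto simp: syncs_def)
    have "(ext q U', ext q' V') \<in> syncs (apex s) (apex t) (rleg s) (lleg t)"
      using m pq pq' by (simp add: syncs_def)
    moreover have "ext q U' \<subseteq># U" "ext q' V' \<subseteq># V"
      using ext_mono[OF that(2), of q] ext_mono[OF that(3), of q'] pq(3)[OF U(1)] pq'(3)[OF U(2)]
      by simp_all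
    ultimately have "(ext q U', ext q' V') = ({#}, {#}) \<or> (ext q U', ext q' V') = (U, V)"
      by (rule min)
    then show ?thesis
      using pq(4)[OF m(1)] pq'(4)[OF m(2)] by auto
  qed
  then have "(ext p U, ext p' V) \<in> min_syncs (apex s') (apex t') (rleg s') (lleg t')"
    using U nz pq pq' by (simp add: min_syncs_def syncs_def)
  moreover have "x = (ext (lleg s') (ext p U), ext (rleg t') (ext p' V))"
    using x U pq pq' by simp
  ultimately show "x \<in> apex (mspan_seq s' t')"
    by (force simp: mspan_seq_def)
qed

lemma mspan_seq_cong:
  assumes "mspan_iso s s'" "mspan_iso t t'"
  shows "mspan_seq s t = mspan_seq s' t'"
proof -
  have "apex (mspan_seq s t) = apex (mspan_seq s' t')"
    using mspan_seq_cong_aux assms mspan_iso_sym by (metis subset_antisym)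
  then show ?thesis using assms by (simp add: mspan_seq_def mspan_iso_def)
qed

lemma mspan_tensor_cong:
  assumes "mspan_iso s s'" "mspan_iso t t'"
  shows "mspan_iso (mspan_tensor s t) (mspan_tensor s' t')"
proof -
  obtain p q where pq: "p \<in> apex s \<rightarrow> msets (apex s')" "q \<in> apex s' \<rightarrow> msets (apex s)"
    "\<And>y. y \<in> apex s \<Longrightarrow> ext q (p y) = rel_id y" "\<And>z. z \<in> apex s' \<Longrightarrow> ext p (q z) = rel_id z"
    "\<And>y. y \<in> apex s \<Longrightarrow> ext (lleg s') (p y) = lleg s y"
    "\<And>y. y \<in> apex s \<Longrightarrow> ext (rleg s') (p y) = rleg s y"
    and st: "src s = src s'" "tgt s = tgt s'"
    using assms(1) unfolding mspan_iso_def rel_comp_apply by auto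
  obtain p' q' where pq': "p' \<in> apex t \<rightarrow> msets (apex t')" "q' \<in> apex t' \<rightarrow> msets (apex t)"
    "\<And>y. y \<in> apex t \<Longrightarrow> ext q' (p' y) = rel_id y" "\<And>z. z \<in> apex t' \<Longrightarrow> ext p' (q' z) = rel_id z"
    "\<And>y. y \<in> apex t \<Longrightarrow> ext (lleg t') (p' y) = lleg t y"
    "\<And>y. y \<in> apex t \<Longrightarrow> ext (rleg t') (p' y) = rleg t y"
    and st': "src t = src t'" "tgt t = tgt t'"
    using assms(2) unfolding mspan_iso_def rel_comp_apply by auto
  have im: "ext h (image_mset g U) = ext (\<lambda>x. h (g x)) U" for h :: "'n \<Rightarrow> 'o multiset" and g :: "'m \<Rightarrow> 'n" and U
    by (induction U) auto
  have mi: "ext (\<lambda>x. image_mset g (h x)) U = image_mset g (ext h U)"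
    for h :: "'m \<Rightarrow> 'n multiset" and g :: "'n \<Rightarrow> 'o" and U
    by (induction U) auto
  let ?P = "case_sum (\<lambda>y. image_mset Inl (p y)) (\<lambda>y. image_mset Inr (p' y))"
  let ?Q = "case_sum (\<lambda>y. image_mset Inl (q y)) (\<lambda>y. image_mset Inr (q' y))"
  show ?thesis
    unfolding mspan_iso_def
  proof (intro conjI bexI[of _ ?P] bexI[of _ ?Q])
    show "?P \<in> apex (mspan_tensor s t) \<rightarrow> msets (apex (mspan_tensor s' t'))"
      using pq(1) pq'(1) by (fastforce simp: mspan_tensor_def msets_def Pi_def)
    show "?Q \<in> apex (mspan_tensor s' t') \<rightarrow> msets (apex (mspan_tensor s t))"
      using pq(2) pq'(2) by (fastforce simp: mspan_tensor_def msets_def Pi_def)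
  qed (use pq(3-) pq'(3-) st st' in
    \<open>auto simp: mspan_tensor_def rel_comp_apply im mi rel_id_def\<close>)
qed

lemma arrow_seq_class:
  assumes "is_mspan s" "is_mspan t"
  shows "mspan_class s ;; mspan_class t = mspan_class (mspan_seq s t)"
proof -
  have "mspan_seq s' t' = mspan_seq s t" if "s' \<in> mspan_class s" "t' \<in> mspan_class t" for s' t'
    using that mspan_seq_cong by (auto simp: mspan_class_def)
  moreover have "mspan_class s \<noteq> {}" "mspan_class t \<noteq> {}"
    using ex_nat_mspan assms by (auto simp: mspan_class_def)
  ultimately show ?thesis by (auto simp: arrow_seq_def)
qed

lemma arrow_tensor_class:
  assumes "is_mspan s" "is_mspan t"
  shows "mspan_class s \<otimes> mspan_class t = mspan_class (mspan_tensor s t)"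
proof -
  have "mspan_class (mspan_tensor s' t') = mspan_class (mspan_tensor s t)"
    if "s' \<in> mspan_class s" "t' \<in> mspan_class t" for s' t'
    using that by (intro mspan_class_eqI mspan_tensor_cong) (auto simp: mspan_class_def)
  moreover have "mspan_class s \<noteq> {}" "mspan_class t \<noteq> {}"
    using ex_nat_mspan assms by (auto simp: mspan_class_def)
  ultimately show ?thesis by (auto simp: arrow_tensor_def)
qed

end

(* Call a span "forward" if its left leg is the inclusion of the singletons, so that it is the
   graph of a function h : n -> M(l). Precomposing such a graph with any span merely applies the
   Kleisli extension of h to the right leg, because a synchronisation is then determined by its
   first component. Hence a span with legs a, b is the composite of the mirror image of the graph
   of a with the graph of b. Forward spans compose and tensor like matrices over the naturals,
   and these are generated by the bialgebra Delta, Bot, Vee, Up with Ident and Cross; the mirror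
   images of these six arrows are again generators. *)

theory Submission
  imports Defs
begin

section \<open>Isomorphisms of spans\<close>

text \<open>A bijection and its inverse, read as singleton-valued maps, are mutually inverse
  multirelations, so isomorphisms below can be given by plain functions.\<close>

lemma mspan_iso_bij:
  assumes "src s = src t" "tgt s = tgt t" and f: "bij_betw f (apex s) (apex t)"
    and "\<And>y. y \<in> apex s \<Longrightarrow> lleg t (f y) = lleg s y"
    and "\<And>y. y \<in> apex s \<Longrightarrow> rleg t (f y) = rleg s y"
  shows "mspan_iso s t"
  unfolding mspan_iso_def rel_comp_apply
  using assms bij_betw_inv_into_left[OF f] bij_betw_inv_into_right[OF f]
    bij_betwE[OF f] bij_betwE[OF bij_betw_inv_into[OF f]]
  by (intro conjI bexI[of _ "\<lambda>y. {#f y#}"] bexI[of _ "\<lambda>z. {#inv_into (apex s) f z#}"])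
     (auto simp: rel_id_def msets_def)

section \<open>Mirror images\<close>

definition mirror :: "'x mspan \<Rightarrow> 'x mspan" where
  "mirror s = \<lparr>src = tgt s, tgt = src s, apex = apex s, lleg = rleg s, rleg = lleg s\<rparr>"

lemma mirror_simps [simp]:
  "src (mirror s) = tgt s" "tgt (mirror s) = src s" "apex (mirror s) = apex s"
  "lleg (mirror s) = rleg s" "rleg (mirror s) = lleg s"
  by (simp_all add: mirror_def)

lemma mirror_mirror [simp]: "mirror (mirror s) = s"
  by (simp add: mirror_def)

lemma is_mspan_mirror [simp]: "is_mspan (mirror s) \<longleftrightarrow> is_mspan s"
  by (auto simp: is_mspan_def inj_on_def)

lemma mspan_iso_mirror: "mspan_iso s t \<Longrightarrow> mspan_iso (mirror s) (mirror t)"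
  unfolding mspan_iso_def by auto

lemma mspan_class_mirror: "mspan_class (mirror s) = mirror ` mspan_class s"
proof -
  have "u \<in> mirror ` mspan_class s" if "u \<in> mspan_class (mirror s)" for u
    using that mspan_iso_mirror[of u "mirror s"]
    by (intro image_eqI[of _ _ "mirror u"]) (auto simp: mspan_class_def)
  then show ?thesis
    by (auto simp: mspan_class_def mspan_iso_mirror)
qed

lemma syncs_swap: "(V, U) \<in> syncs B A g f \<longleftrightarrow> (U, V) \<in> syncs A B f g"
  by (auto simp: syncs_def)

lemma min_syncs_swap: "min_syncs B A g f = prod.swap ` min_syncs A B f g"
proof -
  have "(V, U) \<in> min_syncs B A g f \<longleftrightarrow> (U, V) \<in> min_syncs A B f g" for U V
    unfolding min_syncs_def using syncs_swap[of _ _ B A g f] by auto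
  then show ?thesis by (force simp: image_iff)
qed

text \<open>Only an isomorphism, because the carrier of a composite consists of the pairs of leg
  values, and mirroring swaps their components.\<close>

lemma mspan_seq_mirror: "mspan_iso (mspan_seq (mirror t) (mirror s)) (mirror (mspan_seq s t))"
proof (rule mspan_iso_bij[of _ _ prod.swap])
  have "apex (mspan_seq (mirror t) (mirror s)) = prod.swap ` apex (mspan_seq s t)"
    by (simp add: mspan_seq_def min_syncs_swap[of "apex t"] image_image split_beta)
  then show "bij_betw prod.swap (apex (mspan_seq (mirror t) (mirror s)))
      (apex (mirror (mspan_seq s t)))"
    by (simp add: bij_betw_def image_image)
qed (auto simp: mspan_seq_def)

lemma mspan_tensor_mirror: "mspan_tensor (mirror s) (mirror t) = mirror (mspan_tensor s t)"
  by (simp add: mspan_tensor_def mirror_def)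

lemma arrow_seq_mirror: "(mirror ` G) ;; (mirror ` F) = mirror ` (F ;; G)"
proof -
  have "mspan_class (mspan_seq (mirror t) (mirror s)) = mirror ` mspan_class (mspan_seq s t)"
    for s t :: "nat mspan"
    by (simp add: mspan_class_eqI[OF mspan_seq_mirror] mspan_class_mirror)
  then show ?thesis by (auto simp: arrow_seq_def)
qed

lemma arrow_tensor_mirror: "(mirror ` F) \<otimes> (mirror ` G) = mirror ` (F \<otimes> G)"
  by (auto simp: arrow_tensor_def mspan_tensor_mirror mspan_class_mirror)

fun dual_gen :: "gen \<Rightarrow> gen" where
  "dual_gen Delta = Nabla"
| "dual_gen Bot = Top"
| "dual_gen Nabla = Delta"
| "dual_gen Top = Bot"
| "dual_gen Lambda = Vee"
| "dual_gen Down = Up"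
| "dual_gen Vee = Lambda"
| "dual_gen Up = Down"
| "dual_gen Ident = Ident"
| "dual_gen Cross = Cross"

fun dual :: "expr \<Rightarrow> expr" where
  "dual (Gen c) = Gen (dual_gen c)"
| "dual (Seq d e) = Seq (dual e) (dual d)"
| "dual (Tensor d e) = Tensor (dual d) (dual e)"

lemma has_type_dual: "has_type e k l \<Longrightarrow> has_type (dual e) l k"
proof (induction rule: has_type.induct)
  case (1 c)
  show ?case using has_type.intros(1)[of "dual_gen c"] by (cases c) simp_all
qed (auto intro: has_type.intros)

text \<open>\<open>Cross\<close> alone needs a relabelling of its carrier; every other generator
  mirrors exactly onto its partner.\<close>

lemma mspan_iso_dual_gen: "mspan_iso (gen_mspan (dual_gen c)) (mirror (gen_mspan c))"
proof (cases "c = Cross")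
  case True
  have "bij_betw (\<lambda>i. 1 - i) {0, 1::nat} {0, 1}"
    by (auto simp: bij_betw_def inj_on_def)
  with True show ?thesis by (intro mspan_iso_bij[of _ _ "\<lambda>i. 1 - i"]) auto
next
  case False
  then have "gen_mspan (dual_gen c) = mirror (gen_mspan c)"
    by (cases c) (simp_all add: mirror_def)
  then show ?thesis by (simp add: mspan_iso_refl)
qed

lemma denote_dual: "denote (dual e) = mirror ` denote e"
  by (induction e)
     (simp_all add: arrow_seq_mirror arrow_tensor_mirror mspan_class_eqI[OF mspan_iso_dual_gen]
       mspan_class_mirror)

section \<open>Graphs of functions\<close>

definition graph_span :: "nat \<Rightarrow> nat \<Rightarrow> (nat \<Rightarrow> nat multiset) \<Rightarrow> nat mspan" where
  "graph_span n l h = \<lparr>src = n, tgt = l, apex = {..<n}, lleg = rel_id, rleg = h\<rparr>"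

lemma is_mspan_graph: "h \<in> {..<n} \<rightarrow> msets {..<l} \<Longrightarrow> is_mspan (graph_span n l h)"
  by (auto simp: is_mspan_def graph_span_def rel_id_def msets_def inj_on_def)

text \<open>Matching against singletons forces \<open>V = ext f U\<close>. By monotonicity of
  \<open>ext f\<close>, each \<open>y\<close> in \<open>U\<close> gives the smaller synchronisation
  \<open>({#y#}, f y)\<close>, so a minimal one equals it.\<close>

lemma min_syncs_rel_id:
  assumes "f \<in> A \<rightarrow> msets B"
  shows "min_syncs A B f rel_id = (\<lambda>y. ({#y#}, f y)) ` A"
proof -
  have sync: "(U, V) \<in> syncs A B f rel_id \<longleftrightarrow> U \<in> msets A \<and> V = ext f U" for U V
    using ext_mem[OF assms] by (auto simp: syncs_def)
  have "(U, V) \<in> (\<lambda>y. ({#y#}, f y)) ` A" if "(U, V) \<in> min_syncs A B f rel_id" for U V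
  proof -
    have U: "U \<in> msets A" "V = ext f U" "(U, V) \<noteq> ({#}, {#})"
      and min: "\<And>U' V'. (U', V') \<in> syncs A B f rel_id \<Longrightarrow> U' \<subseteq># U \<Longrightarrow> V' \<subseteq># V \<Longrightarrow>
        (U', V') = ({#}, {#}) \<or> (U', V') = (U, V)"
      using that sync by (auto simp: min_syncs_def)
    \<comment> \<open>If \<open>U\<close> were empty, then \<open>V = ext f U\<close> would be empty
      too.\<close>
    then obtain y where y: "y \<in># U" by fastforce
    then have "y \<in> A" using U by (auto simp: msets_def)
    moreover have "{#y#} \<subseteq># U" using y by simp
    moreover have "f y \<subseteq># V" using ext_mono[OF \<open>{#y#} \<subseteq># U\<close>, of f] U by simp
    ultimately show ?thesis
      using min[of "{#y#}" "f y"] by (auto simp: sync msets_def)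
  qed
  moreover have "({#y#}, f y) \<in> min_syncs A B f rel_id" if "y \<in> A" for y
  proof -
    have "U' \<subseteq># {#y#} \<longleftrightarrow> U' = {#} \<or> U' = {#y#}" for U'
      by (cases U') auto
    then show ?thesis
      using that by (auto simp: min_syncs_def sync msets_def)
  qed
  ultimately show ?thesis by auto
qed

text \<open>Composition may merge elements with equal leg pairs, so \<open>eq\<close> compares
  images only. Joint injectivity of the legs of \<open>u\<close> then supplies the bijection onto
  the composite.\<close>

lemma arrow_seq_graph:
  assumes s: "is_mspan s" and h: "h \<in> {..<tgt s} \<rightarrow> msets {..<l}"
    and u: "is_mspan u" "src u = src s" "tgt u = l"
    and eq: "(\<lambda>y. (lleg s y, ext h (rleg s y))) ` apex s = (\<lambda>y. (lleg u y, rleg u y)) ` apex u"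
  shows "mspan_class s ;; mspan_class (graph_span (tgt s) l h) = mspan_class u"
proof -
  have "rleg s \<in> apex s \<rightarrow> msets {..<tgt s}" using s by (simp add: is_mspan_def)
  then have "apex (mspan_seq s (graph_span (tgt s) l h)) = (\<lambda>y. (lleg u y, rleg u y)) ` apex u"
    unfolding eq[symmetric] by (simp add: mspan_seq_def graph_span_def min_syncs_rel_id image_image)
  then have "mspan_iso u (mspan_seq s (graph_span (tgt s) l h))"
    using u by (intro mspan_iso_bij[of _ _ "\<lambda>y. (lleg u y, rleg u y)"])
      (auto simp: is_mspan_def bij_betw_def mspan_seq_def graph_span_def)
  then show ?thesis
    using s is_mspan_graph[OF h] by (simp add: arrow_seq_class mspan_class_eqI)
qed

section \<open>Generating all graphs\<close>

definition expressible :: "nat \<Rightarrow> nat \<Rightarrow> (nat \<Rightarrow> nat multiset) \<Rightarrow> bool" where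
  "expressible n l h \<longleftrightarrow> h \<in> {..<n} \<rightarrow> msets {..<l} \<and>
     (\<exists>e. has_type e n l \<and> denote e = mspan_class (graph_span n l h))"

lemma expressible_cong:
  assumes "expressible n l h" "\<And>i. i < n \<Longrightarrow> h i = h' i"
  shows "expressible n l h'"
proof -
  have "mspan_iso (graph_span n l h) (graph_span n l h')"
    using assms by (intro mspan_iso_bij[of _ _ "\<lambda>i. i"]) (auto simp: graph_span_def bij_betw_def)
  moreover have "h' \<in> {..<n} \<rightarrow> msets {..<l}"
    using assms by (auto simp: expressible_def Pi_def)
  ultimately show ?thesis
    using assms(1) mspan_class_eqI unfolding expressible_def by metis
qed

lemma expressible_comp:
  assumes "expressible n m h" "expressible m l h'"
  shows "expressible n l (\<lambda>i. ext h' (h i))"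
proof -
  obtain d e where d: "h \<in> {..<n} \<rightarrow> msets {..<m}" "has_type d n m"
      "denote d = mspan_class (graph_span n m h)"
    and e: "h' \<in> {..<m} \<rightarrow> msets {..<l}" "has_type e m l"
      "denote e = mspan_class (graph_span m l h')"
    using assms unfolding expressible_def by blast
  have h: "(\<lambda>i. ext h' (h i)) \<in> {..<n} \<rightarrow> msets {..<l}"
    using d(1) ext_mem[OF e(1)] by auto
  have "mspan_class (graph_span n m h) ;; mspan_class (graph_span m l h')
      = mspan_class (graph_span n l (\<lambda>i. ext h' (h i)))"
    using arrow_seq_graph[OF is_mspan_graph[OF d(1)], of h' l, OF _ is_mspan_graph[OF h]] e(1)
    by (simp add: graph_span_def)
  then have "denote (Seq d e) = mspan_class (graph_span n l (\<lambda>i. ext h' (h i)))"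
    by (simp add: d e)
  then show ?thesis
    using h d(2) e(2) has_type.intros(2) unfolding expressible_def by blast
qed

text \<open>For matrices this is the block diagonal sum; the second block is shifted by
  \<open>n\<close> in the source and by \<open>l\<close> in the target.\<close>

lemma expressible_tensor:
  assumes "expressible n l h" "expressible n' l' h'"
  shows "expressible (n + n') (l + l')
    (\<lambda>i. if i < n then h i else image_mset (\<lambda>j. l + j) (h' (i - n)))"
    (is "expressible _ _ ?h")
proof -
  obtain d e where d: "h \<in> {..<n} \<rightarrow> msets {..<l}" "has_type d n l"
      "denote d = mspan_class (graph_span n l h)"
    and e: "h' \<in> {..<n'} \<rightarrow> msets {..<l'}" "has_type e n' l'"
      "denote e = mspan_class (graph_span n' l' h')"
    using assms unfolding expressible_def by blast
  have h: "?h \<in> {..<n + n'} \<rightarrow> msets {..<l + l'}"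
  proof
    fix i assume "i \<in> {..<n + n'}"
    then have "i < n \<or> \<not> i < n \<and> i - n \<in> {..<n'}" by auto
    then show "?h i \<in> msets {..<l + l'}"
      using d(1) e(1) by (fastforce simp: Pi_def msets_def)
  qed
  have "bij_betw (case_sum (\<lambda>i. i) (\<lambda>i. n + i)) ({..<n} <+> {..<n'}) {..<n + n'}"
  proof (rule bij_betwI[where g = "\<lambda>i. if i < n then Inl i else Inr (i - n)"])
    show "(\<lambda>i. if i < n then Inl i else Inr (i - n)) \<in> {..<n + n'} \<rightarrow> {..<n} <+> {..<n'}"
      by (auto simp: Pi_def split: if_splits)
  qed auto
  then have "mspan_iso (mspan_tensor (graph_span n l h) (graph_span n' l' h'))
      (graph_span (n + n') (l + l') ?h)"
    by (intro mspan_iso_bij[of _ _ "case_sum (\<lambda>i. i) (\<lambda>i. n + i)"])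
      (auto simp: mspan_tensor_def graph_span_def rel_id_def)
  then have "denote (Tensor d e) = mspan_class (graph_span (n + n') (l + l') ?h)"
    using d e by (simp add: arrow_tensor_class is_mspan_graph mspan_class_eqI)
  then show ?thesis
    using h d(2) e(2) has_type.intros(3) unfolding expressible_def by blast
qed

lemma expressible_gen:
  assumes "src (gen_mspan c) = n" "tgt (gen_mspan c) = l" "apex (gen_mspan c) = {..<n}"
    and "\<And>i. i < n \<Longrightarrow> lleg (gen_mspan c) i = {#i#}"
  shows "expressible n l (rleg (gen_mspan c))"
proof -
  have "mspan_iso (gen_mspan c) (graph_span n l (rleg (gen_mspan c)))"
    using assms by (intro mspan_iso_bij[of _ _ "\<lambda>i. i"])
      (auto simp: graph_span_def rel_id_def bij_betw_def)
  moreover have "has_type (Gen c) n l"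
    using assms has_type.intros(1)[of c] by simp
  moreover have "rleg (gen_mspan c) \<in> {..<n} \<rightarrow> msets {..<l}"
    using assms is_mspan_gen[of c] by (simp add: is_mspan_def)
  ultimately show ?thesis
    unfolding expressible_def using mspan_class_eqI by (metis denote.simps(1))
qed

section \<open>Structural maps: identities, permutations and codiagonals\<close>

lemma expressible_gens:
  "expressible 1 2 (\<lambda>_. {#0, 1#})"
  "expressible 1 0 (\<lambda>_. {#})"
  "expressible 2 1 (\<lambda>_. {#0#})"
  "expressible 0 1 (\<lambda>_. {#})"
  "expressible 1 1 (\<lambda>_. {#0#})"
  "expressible 2 2 (\<lambda>i. {#1 - i#})"
  using expressible_gen[of Delta 1 2] expressible_gen[of Bot 1 0] expressible_gen[of Vee 2 1]
    expressible_gen[of Up 0 1] expressible_gen[of Ident 1 1] expressible_gen[of Cross 2 2]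
  by (auto simp: lessThan_Suc numeral_2_eq_2)

lemma expressible_id: "expressible n n rel_id"
proof (induction n)
  case 0
  show ?case
    \<comment> \<open>No generator has type \<open>0\<close> to \<open>0\<close>; creating a wire
      with \<open>Up\<close> and discarding it with \<open>Bot\<close> gives the empty
      identity.\<close>
    using expressible_comp[OF expressible_gens(4,2)] by (rule expressible_cong) simp
next
  case (Suc n)
  show ?case
    using expressible_tensor[OF Suc expressible_gens(5)]
    by (auto simp: rel_id_def less_Suc_eq intro: expressible_cong)
qed

lemma expressible_from_0: "expressible 0 l h"
proof (induction l)
  case 0
  show ?case using expressible_id[of 0] by (rule expressible_cong) simp
next
  case (Suc l)
  show ?case
    using expressible_tensor[OF Suc expressible_gens(4)] by (auto intro: expressible_cong)
qed

text \<open>The cyclic permutation that moves the first wire to the end, as a cascade of adjacent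
  swaps.\<close>

lemma expressible_rotate: "expressible (Suc l) (Suc l) (\<lambda>i. if i = 0 then {#l#} else {#i - 1#})"
proof (induction l)
  case 0
  show ?case using expressible_gens(5) by (auto intro: expressible_cong)
next
  case (Suc l)
  \<comment> \<open>The induction hypothesis brings wire \<open>0\<close> to position
    \<open>l\<close>; this swap of the last two wires takes it past the new one.\<close>
  have "expressible (Suc (Suc l)) (Suc (Suc l))
      (\<lambda>i. if i < l then {#i#} else {#l + (1 - (i - l))#})"
    using expressible_tensor[OF expressible_id[of l] expressible_gens(6)]
    by (auto simp: rel_id_def intro: expressible_cong)
  from expressible_comp[OF expressible_tensor[OF Suc expressible_gens(5)], simplified, OF this]
  show ?case by (rule expressible_cong) auto
qed

text \<open>The codiagonal, which adds two blocks of \<open>l\<close> wires entrywise.\<close>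

lemma expressible_fold: "expressible (l + l) l (\<lambda>i. if i < l then {#i#} else {#i - l#})"
proof (induction l)
  case 0
  show ?case using expressible_from_0[of 0] by simp
next
  case (Suc l)
  \<comment> \<open>Rotation moves the last wire of the first block to position
    \<open>l + l\<close>, next to the last wire of the second. \<open>Vee\<close> merges these two,
    and the induction hypothesis folds the rest.\<close>
  let ?r = "\<lambda>i. if i < l then {#i#} else if i = l then {#l + l#} else if i \<le> l + l then {#i - 1#}
    else {#i#}"
  have "expressible (l + Suc l) (l + Suc l)
      (\<lambda>i. if i < l then {#i#} else if i = l then {#l + l#} else {#i - 1#})"
    using expressible_tensor[OF expressible_id[of l] expressible_rotate[of l]]
    by (rule expressible_cong) (auto simp: rel_id_def)
  from expressible_tensor[OF this expressible_gens(5)]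
  have r: "expressible (l + l + 2) (l + l + 2) ?r"
    by (auto intro: expressible_cong)
  have "expressible (l + l + 2) (Suc l)
      (\<lambda>i. if i < l then {#i#} else if i < l + l then {#i - l#} else {#l#})"
    using expressible_tensor[OF Suc expressible_gens(3)] by (auto intro: expressible_cong)
  from expressible_comp[OF r this]
  have "expressible (l + l + 2) (Suc l) (\<lambda>i. if i < Suc l then {#i#} else {#i - Suc l#})"
    by (rule expressible_cong) auto
  then show ?case by simp
qed

section \<open>Assembling an arbitrary matrix\<close>

text \<open>The copairing is the tensor of the two maps followed by the codiagonal.\<close>

lemma expressible_copair:
  assumes "expressible n l h" "expressible n' l h'"
  shows "expressible (n + n') l (\<lambda>i. if i < n then h i else h' (i - n))"
proof -
  let ?f = "\<lambda>i. if i < l then {#i#} else {#i - l#}"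
  have left: "ext ?f U = U" if "U \<in> msets {..<l}" for U
    using ext_cong[OF that, of ?f rel_id] by (simp add: rel_id_def)
  have right: "ext ?f (image_mset (\<lambda>j. l + j) U) = U" for U
    by (induction U) auto
  have h: "h i \<in> msets {..<l}" if "i < n" for i
    using that assms(1) by (auto simp: expressible_def)
  from expressible_comp[OF expressible_tensor[OF assms] expressible_fold] show ?thesis
    by (rule expressible_cong) (use h in \<open>simp add: left right\<close>)
qed

lemma expressible_singleton:
  assumes "i < l"
  shows "expressible 1 l (\<lambda>_. {#i#})"
proof -
  \<comment> \<open>One identity wire is padded with \<open>i\<close> zero wires before it and
    \<open>l - i - 1\<close> after it.\<close>
  have "expressible 1 (i + (1 + (l - i - 1))) (\<lambda>_. {#i#})"
    using expressible_tensor[OF expressible_from_0[of i "\<lambda>_. {#}"]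
        expressible_tensor[OF expressible_gens(5) expressible_from_0[of "l - i - 1" "\<lambda>_. {#}"]]]
    by (auto intro: expressible_cong)
  then show ?thesis using assms by simp
qed

text \<open>\<open>Delta\<close> copies the input, and copairing adds the results for one element
  and for the remaining multiset; repetition produces the multiplicities.\<close>

lemma expressible_multiset: "U \<in> msets {..<l} \<Longrightarrow> expressible 1 l (\<lambda>_. U)"
proof (induction U)
  case empty
  show ?case
    using expressible_comp[OF expressible_gens(2) expressible_from_0[of l "\<lambda>_. {#}"]] by simp
next
  case (add i U)
  then have "expressible 1 l (\<lambda>_. {#i#})" "expressible 1 l (\<lambda>_. U)"
    using expressible_singleton[of i l] by (simp_all add: msets_def)
  from expressible_comp[OF expressible_gens(1)
      expressible_copair[OF this, folded one_add_one[symmetric]]]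
  show ?case by simp
qed

lemma expressible_all: "h \<in> {..<n} \<rightarrow> msets {..<l} \<Longrightarrow> expressible n l h"
proof (induction n)
  case 0
  show ?case by (rule expressible_from_0)
next
  case (Suc n)
  then have "expressible n l h" "expressible 1 l (\<lambda>_. h n)"
    using expressible_multiset[of "h n" l] by (simp_all add: Pi_def)
  from expressible_copair[OF this] show ?case
    by (auto simp: less_Suc_eq intro: expressible_cong)
qed

theorem theorem3:
  fixes k l :: nat and F :: arrow
  assumes "F \<in> Spr_arrows k l"
  shows "\<exists>e. has_type e k l \<and> denote e = F"
proof -
  obtain s :: "nat mspan" where s: "F = mspan_class s" "is_mspan s" "src s = k" "tgt s = l"
    using assms by (auto simp: Spr_arrows_def)
  \<comment> \<open>Enumerating the carrier by \<open>{..<n}\<close> turns both legs into functions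
    whose graphs are expressible.\<close>
  obtain n and f :: "nat \<Rightarrow> nat" where f: "apex s = f ` {..<n}"
    using s finite_imp_nat_seg_image_inj_on[of "apex s"]
    by (auto simp: is_mspan_def lessThan_def)
  let ?a = "lleg s \<circ> f" and ?b = "rleg s \<circ> f"
  have legs: "?a \<in> {..<n} \<rightarrow> msets {..<k}" "?b \<in> {..<n} \<rightarrow> msets {..<l}"
    using s f by (auto simp: is_mspan_def)
  then obtain d e where d: "has_type d n k" "denote d = mspan_class (graph_span n k ?a)"
    and e: "has_type e n l" "denote e = mspan_class (graph_span n l ?b)"
    using expressible_all unfolding expressible_def by meson
  have "denote (Seq (dual d) e)
      = mspan_class (mirror (graph_span n k ?a)) ;; mspan_class (graph_span n l ?b)"
    by (simp add: denote_dual d e mspan_class_mirror)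
  also have "\<dots> = F"
    \<comment> \<open>Since the right leg of the mirrored graph is \<open>rel_id\<close>, the
      composite has leg pairs \<open>(?a i, ?b i)\<close>, which are those of \<open>s\<close>
      itself.\<close>
    using arrow_seq_graph[of "mirror (graph_span n k ?a)" ?b l s] legs s f
    by (simp add: is_mspan_graph) (simp add: graph_span_def image_image rel_id_def)
  finally show ?thesis
    using has_type.intros(2)[OF has_type_dual[OF d(1)] e(1)] by blast
qed

end
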